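(* Let $\mathcal{H}$ be a real Hilbert space, let $C$ be a nonempty closed convex subset of $\mathcal{H}$, let $\alpha\in\,]0,+\infty[$, let $p\in[1,+\infty[$, and set $f=\alpha d_C^p$. Then the following hold. (i) Suppose that $p=1$. Then $$(\forall x\in\mathcal{H})\quad\operatorname{prox}_f x=\begin{cases}x+\dfrac{\alpha}{d_C(x)}(P_Cx-x),&\text{if } d_C(x)>\alpha;\\[2mm] P_Cx,&\text{if } d_C(x)\leq\alpha.\end{cases}$$ (ii) Suppose that $p>1$. Then $$(\forall x\in\mathcal{H})\quad\operatorname{prox}_f x=\begin{cases}x+\dfrac{\nu(x)}{d_C(x)}(P_Cx-x),&\text{if } x\notin C;\\[2mm] x,&\text{if } x\in C,\end{cases}$$ where $\nu(x)$ is the unique real number in $[0,+\infty[$ that satisfies $\nu(x)+\big(\nu(x)/(\alpha p)\big)^{1/(p-1)}=d_C(x)$.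
   Context: $d_C(x)=\inf_{y\in C}\|x-y\|$ is the distance function to $C$ and $P_Cx$ is the projection of $x$ onto $C$, i.e. the unique point of $C$ with $\|x-P_Cx\|=d_C(x)$. For a proper lower semicontinuous convex function $f\colon\mathcal{H}\to\,]-\infty,+\infty]$, the proximity operator $\operatorname{prox}_f$ maps $x$ to the unique minimizer over $y\in\mathcal{H}$ of $f(y)+\frac12\|x-y\|^2$. *)

theory Defs
  imports "HOL-Analysis.Analysis"
begin

text \<open>
  Real Hilbert spaces are rendered by the sort \<open>{real_inner, complete_space}\<close>.
  The library constant \<^term>\<open>closest_point\<close> requires \<open>heine_borel\<close>, which would force finite
  dimension, so the projection is defined here without that restriction.
\<close>

definition proj :: "'a::real_inner set \<Rightarrow> 'a \<Rightarrow> 'a"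
  where "proj C x = (THE y. y \<in> C \<and> norm (x - y) = infdist x C)"

text \<open>
  Both \<^term>\<open>proj\<close> and the proximity operator use definite description: when the point described
  fails to exist or to be unique, the value is unspecified. An extended-real-valued \<open>f\<close> is meant to
  be proper, lower semicontinuous and convex.
\<close>

definition prox :: "('a::real_inner \<Rightarrow> ereal) \<Rightarrow> 'a \<Rightarrow> 'a"
  where "prox f x =
    (THE y. is_arg_min (\<lambda>z. f z + ereal (1 / 2 * (norm (x - z))\<^sup>2)) (\<lambda>_. True) y)"

end

theory Submission
  imports Defs
begin

text \<open>
  Write \<open>d\<close> for the distance from \<open>x\<close> to \<open>C\<close>. The distance function is 1-Lipschitz, so a point \<open>y\<close>
  at distance \<open>r\<close> from \<open>x\<close> satisfies \<open>infdist y C \<ge> d - r\<close>, with equality when \<open>y\<close> lies on the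
  segment from \<open>x\<close> to its projection. For \<open>g\<close> nondecreasing, minimising
  \<open>g (infdist y C) + r\<^sup>2 / 2\<close> is therefore the scalar problem of minimising \<open>g s + (d - s)\<^sup>2 / 2\<close>
  over \<open>s \<ge> 0\<close>, and for convex \<open>g\<close> its solution is \<open>s = d - \<nu>\<close> where \<open>\<nu>\<close> is a subgradient of \<open>g\<close> at
  \<open>d - \<nu>\<close>. The lemma \<open>prox_comp_infdist\<close> makes this precise: such a \<open>\<nu> \<in> {0..d}\<close> is the length
  of the step that the proximity operator takes from \<open>x\<close> towards the projection.

  It remains to find \<open>\<nu>\<close>. For \<open>g s = \<alpha> * s\<close> the slope \<open>\<alpha>\<close> is the only subgradient at points
  \<open>s > 0\<close>, which gives \<open>\<nu> = \<alpha>\<close> when \<open>d > \<alpha>\<close>, while at \<open>s = 0\<close> every number in \<open>{0..\<alpha>}\<close> is a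
  subgradient on the half-line, which gives \<open>\<nu> = d\<close> otherwise. For \<open>g s = \<alpha> * s powr p\<close> with
  \<open>p > 1\<close> the condition is \<open>\<nu> = \<alpha> * p * (d - \<nu>) powr (p - 1)\<close>, which is the equation of the
  statement solved for the other occurrence of \<open>\<nu>\<close>; the tangent inequality comes from Young's inequality.
\<close>

section \<open>Projections in Hilbert space\<close>

text \<open>
  The midpoint of \<open>z\<close> and \<open>w\<close> lies in \<open>C\<close>, hence no closer to \<open>x\<close> than \<open>infdist x C\<close>; the
  parallelogram law then bounds the distance of \<open>z\<close> and \<open>w\<close>. Almost nearest points are thus close to
  each other, which yields existence as well as uniqueness of the projection.
\<close>

lemma almost_nearest_points_close:
  fixes C :: "'a::real_inner set"
  assumes "convex C" "z \<in> C" "w \<in> C" "dist x z \<le> r" "dist x w \<le> r"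
  shows "(dist z w)\<^sup>2 \<le> 4 * (r\<^sup>2 - (infdist x C)\<^sup>2)"
proof -
  have "midpoint z w \<in> C"
    using assms convexD[of C z w "1/2" "1/2"] by (simp add: midpoint_def scaleR_add_right)
  then have "infdist x C \<le> dist x (midpoint z w)"
    by (rule infdist_le)
  then have 1: "(infdist x C)\<^sup>2 \<le> (dist x (midpoint z w))\<^sup>2"
    by (simp add: infdist_nonneg power_mono)
  have "x - midpoint z w = (1/2) *\<^sub>R ((x - z) + (x - w))"
    by (simp add: midpoint_def algebra_simps flip: scaleR_add_left)
  then have 2: "4 * (dist x (midpoint z w))\<^sup>2 = (norm ((x - z) + (x - w)))\<^sup>2"
    by (simp add: dist_norm power_divide)
  have "(norm ((x - z) + (x - w)))\<^sup>2 + (norm (z - w))\<^sup>2 = 2 * (norm (x - z))\<^sup>2 + 2 * (norm (x - w))\<^sup>2"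
    by (simp add: power2_norm_eq_inner inner_diff inner_add inner_commute)
  moreover have "(norm (x - z))\<^sup>2 \<le> r\<^sup>2" "(norm (x - w))\<^sup>2 \<le> r\<^sup>2"
    using assms by (auto simp: dist_norm intro!: power_mono)
  ultimately show ?thesis
    using 1 2 by (simp add: dist_norm)
qed

lemma nearest_point_exists_unique:
  fixes C :: "'a::{real_inner, complete_space} set"
  assumes "C \<noteq> {}" "closed C" "convex C"
  shows "\<exists>!y. y \<in> C \<and> norm (x - y) = infdist x C"
proof -
  define d where "d = infdist x C"
  have d0: "0 \<le> d"
    by (simp add: d_def infdist_nonneg)
  define S where "S n = C \<inter> cball x (d + 1 / real (Suc n))" for n
  have "\<exists>a. \<forall>n. a \<in> S n"
  proof (rule decreasing_closed_nest[of S])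
    show "closed (S n)" for n
      using assms by (auto simp: S_def)
    show "S n \<noteq> {}" for n
    proof -
      have "(INF a\<in>C. dist x a) < d + 1 / real (Suc n)"
        using assms by (simp add: d_def infdist_notempty)
      then obtain a where "a \<in> C" "dist x a < d + 1 / real (Suc n)"
        using assms by (subst (asm) cINF_less_iff) auto
      then show ?thesis
        by (auto simp: S_def)
    qed
    show "S n \<subseteq> S m" if "m \<le> n" for m n
    proof -
      have "1 / real (Suc n) \<le> 1 / real (Suc m)"
        using that by (simp add: frac_le)
      then show ?thesis
        by (auto simp: S_def)
    qed
    show "\<exists>n. \<forall>u\<in>S n. \<forall>v\<in>S n. dist u v < e" if "e > 0" for e
    proof -
      have "(\<lambda>n. 4 * ((d + 1 / real (Suc n))\<^sup>2 - d\<^sup>2)) \<longlonglongrightarrow> 4 * ((d + 0)\<^sup>2 - d\<^sup>2)"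
        by (intro tendsto_intros LIMSEQ_Suc lim_1_over_n)
      then have "\<forall>\<^sub>F n in sequentially. 4 * ((d + 1 / real (Suc n))\<^sup>2 - d\<^sup>2) < e\<^sup>2"
        using that by (intro order_tendstoD(2)) auto
      then obtain n where n: "4 * ((d + 1 / real (Suc n))\<^sup>2 - d\<^sup>2) < e\<^sup>2"
        by (auto simp: eventually_sequentially)
      have "dist u v < e" if "u \<in> S n" "v \<in> S n" for u v
      proof -
        have "(dist u v)\<^sup>2 < e\<^sup>2"
          using almost_nearest_points_close[OF \<open>convex C\<close>, of u v x "d + 1 / real (Suc n)"] that n
          by (auto simp: S_def d_def)
        then show ?thesis
          using \<open>e > 0\<close> by (simp add: power2_less_imp_less)
      qed
      then show ?thesis
        by blast
    qed
  qed blast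
  then obtain a where a: "\<And>n. a \<in> S n"
    by blast
  have "(\<lambda>n. d + 1 / real (Suc n)) \<longlonglongrightarrow> d + 0"
    by (intro tendsto_intros LIMSEQ_Suc lim_1_over_n)
  moreover have "dist x a \<le> d + 1 / real (Suc n)" for n
    using a[of n] by (simp add: S_def)
  ultimately have "dist x a \<le> d"
    using LIMSEQ_le_const[of "\<lambda>n. d + 1 / real (Suc n)" "d + 0" "dist x a"] by auto
  moreover have aC: "a \<in> C"
    using a[of 0] by (simp add: S_def)
  ultimately have "dist x a = d"
    using infdist_le[OF aC, of x] by (simp add: d_def)
  moreover have "y = z" if "y \<in> C" "z \<in> C" "dist x y = d" "dist x z = d" for y z
    using almost_nearest_points_close[OF \<open>convex C\<close> that(1,2), of x d] that by (simp add: d_def)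
  ultimately show ?thesis
    using aC by (intro ex1I[of _ a]) (auto simp: dist_norm d_def)
qed

lemma
  fixes C :: "'a::{real_inner, complete_space} set"
  assumes "C \<noteq> {}" "closed C" "convex C"
  shows proj_in_set: "proj C x \<in> C"
    and norm_diff_proj: "norm (x - proj C x) = infdist x C"
  using theI'[OF nearest_point_exists_unique[OF assms, of x]] by (auto simp: proj_def)

lemma proj_eqI:
  fixes C :: "'a::{real_inner, complete_space} set"
  assumes "C \<noteq> {}" "closed C" "convex C" "y \<in> C" "norm (x - y) \<le> infdist x C"
  shows "proj C x = y"
proof -
  have "norm (x - y) = infdist x C"
    using assms infdist_le[of y C x] by (simp add: dist_norm)
  then show ?thesis
    using nearest_point_exists_unique[OF assms(1-3), of x] proj_in_set[OF assms(1-3)]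
      norm_diff_proj[OF assms(1-3)] assms(4) by blast
qed

section \<open>Proximity operators of functions of the distance\<close>

lemma prox_eqI:
  fixes F :: "'a::real_inner \<Rightarrow> real"
  assumes "\<And>y. y \<noteq> q \<Longrightarrow> F q + 1/2 * (norm (x - q))\<^sup>2 < F y + 1/2 * (norm (x - y))\<^sup>2"
  shows "prox (\<lambda>z. ereal (F z)) x = q"
  unfolding prox_def
proof (rule the_equality)
  show "is_arg_min (\<lambda>z. ereal (F z) + ereal (1/2 * (norm (x - z))\<^sup>2)) (\<lambda>_. True) q"
    using assms by (force simp: is_arg_min_def)
next
  fix y
  assume "is_arg_min (\<lambda>z. ereal (F z) + ereal (1/2 * (norm (x - z))\<^sup>2)) (\<lambda>_. True) y"
  then show "y = q"
    using assms[of y] by (auto simp: is_arg_min_def)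
qed

text \<open>
  Put \<open>s = infdist y C\<close>, \<open>r = norm (x - y)\<close> and \<open>t = infdist x C - \<nu>\<close>. The subgradient inequality and
  \<open>s - t \<ge> \<nu> - r\<close> give \<open>g s + r\<^sup>2 / 2 \<ge> g t + \<nu>\<^sup>2 / 2 + (\<nu> - r)\<^sup>2 / 2\<close>, and \<open>g t + \<nu>\<^sup>2 / 2\<close> is
  attained by the point claimed. A second minimiser \<open>y\<close> would have \<open>r = \<nu>\<close> and \<open>s \<le> t\<close>, so that
  going from \<open>x\<close> via \<open>y\<close> to the projection of \<open>y\<close> costs no more than \<open>infdist x C\<close>. Then the
  triangle inequality is an equality and \<open>y\<close> lies on the segment from \<open>x\<close> to its own projection, at
  distance \<open>\<nu>\<close> from \<open>x\<close>.
\<close>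

lemma prox_comp_infdist:
  fixes C :: "'a::{real_inner, complete_space} set" and g :: "real \<Rightarrow> real"
  assumes C: "C \<noteq> {}" "closed C" "convex C"
    and \<nu>: "0 \<le> \<nu>" "\<nu> \<le> infdist x C"
    and subgradient: "\<And>s. 0 \<le> s \<Longrightarrow> g (infdist x C - \<nu>) + \<nu> * (s - (infdist x C - \<nu>)) \<le> g s"
  shows "prox (\<lambda>z. ereal (g (infdist z C))) x = x + (\<nu> / infdist x C) *\<^sub>R (proj C x - x)"
    (is "_ = ?q")
proof (rule prox_eqI, rule ccontr)
  define d where "d = infdist x C"
  define t where "t = d - \<nu>"
  have Pd: "norm (proj C x - x) = d"
    using norm_diff_proj[OF C, of x] by (simp add: d_def norm_minus_commute)
  have xq: "norm (x - ?q) = \<nu>"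
    using Pd \<nu> by (cases "d = 0") (auto simp: d_def)
  have "proj C x - ?q = (1 - \<nu> / d) *\<^sub>R (proj C x - x)"
    by (simp add: d_def algebra_simps)
  also have "norm \<dots> = t"
  proof (cases "d = 0")
    case False
    then have "0 < d" "\<nu> / d \<le> 1"
      using \<nu> by (auto simp: d_def divide_le_eq_1)
    then show ?thesis
      by (simp add: Pd t_def left_diff_distrib)
  qed (use Pd \<nu> in \<open>auto simp: t_def d_def\<close>)
  finally have "dist ?q (proj C x) = t"
    by (simp add: dist_norm norm_minus_commute)
  then have "infdist ?q C \<le> t"
    using infdist_le[OF proj_in_set[OF C], of ?q x] by simp
  moreover have "d \<le> infdist ?q C + \<nu>"
    using infdist_triangle[of x C ?q] xq by (simp add: d_def dist_norm)
  ultimately have dq: "infdist ?q C = t"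
    by (simp add: t_def)

  fix y
  assume "y \<noteq> ?q"
  define s where "s = infdist y C"
  define r where "r = norm (x - y)"
  assume "\<not> g (infdist ?q C) + 1/2 * (norm (x - ?q))\<^sup>2 < g (infdist y C) + 1/2 * (norm (x - y))\<^sup>2"
  then have le: "g s + 1/2 * r\<^sup>2 \<le> g t + 1/2 * \<nu>\<^sup>2"
    unfolding xq dq by (simp add: s_def r_def)
  have sub: "g t + \<nu> * (s - t) \<le> g s"
    using subgradient[of s] by (simp add: s_def t_def d_def infdist_nonneg)
  have "\<nu> - r \<le> s - t"
    using infdist_triangle[of x C y] by (simp add: s_def r_def t_def d_def dist_norm)
  then have "\<nu> * (\<nu> - r) \<le> \<nu> * (s - t)"
    using \<nu> by (intro mult_left_mono)
  with le sub have "(\<nu> - r)\<^sup>2 \<le> 0"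
    by (simp add: power2_eq_square algebra_simps)
  then have r: "r = \<nu>"
    by simp
  have "\<nu> \<noteq> 0"
    using r \<open>y \<noteq> ?q\<close> by (auto simp: r_def)
  have "\<nu> * (s - t) \<le> 0"
    using le sub r by simp
  with \<open>\<nu> \<noteq> 0\<close> \<nu> have "s \<le> t"
    by (simp add: mult_le_0_iff)
  define w where "w = proj C y"
  have yw: "norm (y - w) = s"
    using norm_diff_proj[OF C, of y] by (simp add: w_def s_def)
  have xw: "norm (x - w) \<le> norm (x - y) + norm (y - w)"
    using norm_triangle_ineq[of "x - y" "y - w"] by simp
  also have "\<dots> \<le> d"
    using \<open>s \<le> t\<close> r yw by (simp add: r_def t_def)
  finally have w: "proj C x = w"
    by (intro proj_eqI[OF C]) (auto simp: w_def d_def proj_in_set[OF C])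
  then have "norm (x - w) = d"
    using Pd by (simp add: norm_minus_commute)
  with xw \<open>s \<le> t\<close> r yw have "norm ((x - y) + (y - w)) = norm (x - y) + norm (y - w)" and s: "s = t"
    by (auto simp: r_def t_def)
  then have "norm (x - y) *\<^sub>R (y - w) = norm (y - w) *\<^sub>R (x - y)"
    by (simp only: norm_triangle_eq)
  then have "\<nu> *\<^sub>R (y - w) = (d - \<nu>) *\<^sub>R (x - y)"
    using r yw s by (simp add: r_def t_def)
  then have "d *\<^sub>R y = d *\<^sub>R x + \<nu> *\<^sub>R (w - x)"
    by (simp add: algebra_simps)
  moreover have "d \<noteq> 0"
    using \<open>\<nu> \<noteq> 0\<close> \<nu> by (auto simp: d_def)
  ultimately have "d *\<^sub>R y = d *\<^sub>R (x + (\<nu> / d) *\<^sub>R (w - x))"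
    by (simp add: scaleR_add_right)
  then have "y = ?q"
    using \<open>d \<noteq> 0\<close> w by (simp add: d_def)
  with \<open>y \<noteq> ?q\<close> show False ..
qed

section \<open>Powers\<close>

text \<open>
  This is Young's inequality for \<open>s\<close> and \<open>t powr (p - 1)\<close>, multiplied by \<open>p\<close>. In this form it
  covers the boundary cases \<open>s = 0\<close> and \<open>t = 0\<close>.
\<close>

lemma powr_ge_tangent:
  fixes p s t :: real
  assumes "1 < p" "0 \<le> s" "0 \<le> t"
  shows "t powr p + p * t powr (p - 1) * (s - t) \<le> s powr p"
proof -
  have "s * t powr (p - 1) \<le> s powr p / p + (t powr (p - 1)) powr (p / (p - 1)) / (p / (p - 1))"
    using assms by (intro Youngs_inequality) (auto simp: field_simps)
  also have "(t powr (p - 1)) powr (p / (p - 1)) = t powr p"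
    using assms by (simp add: powr_powr)
  finally have "p * (s * t powr (p - 1)) \<le> p * (s powr p / p + t powr p / (p / (p - 1)))"
    using assms by simp
  also have "\<dots> = s powr p + (p - 1) * t powr p"
    using assms by (simp add: distrib_left)
  finally have "p * s * t powr (p - 1) \<le> s powr p + (p - 1) * t powr p"
    by (simp add: mult.assoc)
  moreover have "t powr (p - 1) * t = t powr p"
    using assms by (cases "t = 0") (auto simp: powr_diff)
  ultimately show ?thesis
    by (simp add: algebra_simps)
qed

text \<open>
  The left-hand side is continuous and strictly increasing, vanishes at \<open>t = 0\<close>, and is at least \<open>d\<close>
  at \<open>t = d\<close>.
\<close>

lemma ex1_add_powr_eq:
  fixes c b d :: real
  assumes "0 < c" "0 < b" "0 \<le> d"
  shows "\<exists>!t. 0 \<le> t \<and> t + (t / c) powr b = d"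
proof (rule ex_ex1I)
  have "continuous_on {0..d} (\<lambda>t. t + (t / c) powr b)"
    using assms by (intro continuous_intros continuous_on_powr') auto
  then show "\<exists>t. 0 \<le> t \<and> t + (t / c) powr b = d"
    using IVT'[of "\<lambda>t. t + (t / c) powr b" 0 d d] assms by auto
next
  fix t u
  assume t: "0 \<le> t \<and> t + (t / c) powr b = d" and u: "0 \<le> u \<and> u + (u / c) powr b = d"
  have less: "v + (v / c) powr b < w + (w / c) powr b" if "0 \<le> v" "v < w" for v w
    using that assms by (intro add_strict_mono powr_less_mono2 divide_strict_right_mono) auto
  show "t = u"
    using less[of t u] less[of u t] t u by (cases t u rule: linorder_cases) auto
qed

section \<open>Powers of the distance\<close>

theorem proposition2p8:
  fixes C :: "'a::{real_inner, complete_space} set"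
    and \<alpha> p :: real
    and f :: "'a \<Rightarrow> ereal"
  assumes "C \<noteq> {}" and "closed C" and "convex C"
    and "0 < \<alpha>" and "1 \<le> p"
    and "f = (\<lambda>x. ereal (\<alpha> * infdist x C powr p))"
  shows "(p = 1 \<longrightarrow>
            (\<forall>x. prox f x =
              (if infdist x C > \<alpha> then x + (\<alpha> / infdist x C) *\<^sub>R (proj C x - x)
               else proj C x)))
       \<and> (p > 1 \<longrightarrow>
            (\<forall>x. \<exists>!t::real. 0 \<le> t \<and> t + (t / (\<alpha> * p)) powr (1 / (p - 1)) = infdist x C) \<and>
            (\<forall>\<nu> :: 'a \<Rightarrow> real.
              (\<forall>x. 0 \<le> \<nu> x \<and> \<nu> x + (\<nu> x / (\<alpha> * p)) powr (1 / (p - 1)) = infdist x C) \<longrightarrow>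
              (\<forall>x. prox f x =
                (if x \<notin> C then x + (\<nu> x / infdist x C) *\<^sub>R (proj C x - x)
                 else x))))"
proof (intro conjI impI allI)
  note C = assms(1-3)
  fix x
  assume p: "p = 1"
  have f: "f = (\<lambda>z. ereal (\<alpha> * infdist z C))"
    using assms(6) by (auto simp: p infdist_nonneg)
  show "prox f x = (if infdist x C > \<alpha> then x + (\<alpha> / infdist x C) *\<^sub>R (proj C x - x) else proj C x)"
  proof (cases "infdist x C > \<alpha>")
    case True
    then show ?thesis
      unfolding f using \<open>0 < \<alpha>\<close> prox_comp_infdist[OF C, of \<alpha> x "\<lambda>s. \<alpha> * s"]
      by (simp add: algebra_simps)
  next
    case False
    then have "prox f x = x + (infdist x C / infdist x C) *\<^sub>R (proj C x - x)"
      unfolding f by (intro prox_comp_infdist[OF C]) (auto simp: infdist_nonneg mult_right_mono)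
    also have "\<dots> = proj C x"
      using norm_diff_proj[OF C, of x] by (cases "infdist x C = 0") auto
    finally show ?thesis
      using False by simp
  qed
next
  fix x
  assume "1 < p"
  then show "\<exists>!t. 0 \<le> t \<and> t + (t / (\<alpha> * p)) powr (1 / (p - 1)) = infdist x C"
    using \<open>0 < \<alpha>\<close> by (intro ex1_add_powr_eq) (auto simp: infdist_nonneg)
next
  note C = assms(1-3)
  fix \<nu> :: "'a \<Rightarrow> real" and x
  assume p: "1 < p"
    and \<nu>_all: "\<forall>x. 0 \<le> \<nu> x \<and> \<nu> x + (\<nu> x / (\<alpha> * p)) powr (1 / (p - 1)) = infdist x C"
  have \<nu>0: "0 \<le> \<nu> x"
    using \<nu>_all by blast
  have t: "infdist x C - \<nu> x = (\<nu> x / (\<alpha> * p)) powr (1 / (p - 1))"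
    using \<nu>_all by (metis add_diff_cancel_left')
  then have t0: "0 \<le> infdist x C - \<nu> x"
    by simp
  have "(infdist x C - \<nu> x) powr (p - 1) = \<nu> x / (\<alpha> * p)"
    unfolding t using p \<nu>0 \<open>0 < \<alpha>\<close> by (simp add: powr_powr)
  then have slope: "\<alpha> * (p * (infdist x C - \<nu> x) powr (p - 1)) = \<nu> x"
    using p \<open>0 < \<alpha>\<close> by simp
  have "\<alpha> * (infdist x C - \<nu> x) powr p + \<nu> x * (s - (infdist x C - \<nu> x)) \<le> \<alpha> * s powr p"
    if "0 \<le> s" for s
    using mult_left_mono[OF powr_ge_tangent[OF p that t0], of \<alpha>] \<open>0 < \<alpha>\<close>
    by (simp only: distrib_left mult.assoc[symmetric] slope[unfolded mult.assoc[symmetric]])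
  then have "prox f x = x + (\<nu> x / infdist x C) *\<^sub>R (proj C x - x)"
    unfolding assms(6) using \<nu>0 t0
    by (intro prox_comp_infdist[OF C, of "\<nu> x" x "\<lambda>s. \<alpha> * s powr p"]) auto
  \<comment> \<open>On \<open>C\<close> the formula reads \<open>x\<close> as well, the quotient by \<open>infdist x C = 0\<close> being \<open>0\<close>.\<close>
  then show "prox f x = (if x \<notin> C then x + (\<nu> x / infdist x C) *\<^sub>R (proj C x - x) else x)"
    by simp
qed

end
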